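(* Let $U$ be an $L_1$ component. Suppose the compiler ${\downarrow}^1_2$ is correct with respect to $U$ and behaviors are invertible. Then for every $L_3$ context $A$, $A\in\mathsf{Exploit}^2_3({\downarrow}^1_2U)$ implies $A\in\mathsf{Exploit}^1_3(U)$.
   Context: There are three languages $L_1,L_2,L_3$. Each $L_i$ has whole programs, components, contexts, and a set of behaviors $\mathcal{B}^i$. Linking a context $C$ with a component $U$ of the same language gives a whole program $C[U]$ (assumed always well-defined). Each whole program $P$ of $L_i$ has a behavior $B(P)\in\mathcal{B}^i$. There are compilers ${\downarrow}^1_2$ (from $L_1$ to $L_2$) and ${\downarrow}^2_3$ (from $L_2$ to $L_3$), each mapping whole programs, components and contexts to whole programs, components and contexts respectively, and each modular: $B({\downarrow}(C[U]))=B({\downarrow}C[{\downarrow}U])$. Their composite (first ${\downarrow}^1_2$, then ${\downarrow}^2_3$) is ${\downarrow}^1_3$. Arbitrary relations $\mapsto^1_2\subseteq\mathcal{B}^1\times\mathcal{B}^2$ and $\mapsto^2_3\subseteq\mathcal{B}^2\times\mathcal{B}^3$ are given, and $b^1\mapsto^1_3b^3$ means that there exists $b^2\in\mathcal{B}^2$ with $b^1\mapsto^1_2b^2$ and $b^2\mapsto^2_3b^3$. An attacker set $\mathcal{A}_3$ of $L_3$ contexts is fixed. For $i\in\{1,2\}$ and an $L_i$ component $V$, $$\mathsf{Exploit}^i_3(V)=\{A\in\mathcal{A}_3\mid\text{there is no } L_i \text{ context } C \text{ with } B(C[V])\mapsto^i_3B(A[{\downarrow}^i_3V])\}.$$ The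 compiler ${\downarrow}^i_j$ is correct with respect to an $L_i$ component $U$ if $B(C[U])\mapsto^i_jB({\downarrow}^i_jC[{\downarrow}^i_jU])$ for every $L_i$ context $C$. Behaviors are invertible if for all $b^1,b^3$: $b^1\mapsto^1_3b^3$ implies that for all $b^2\in\mathcal{B}^2$, $b^2\mapsto^2_3b^3\iff b^1\mapsto^1_2b^2$. *)

theory Defs
  imports Main
begin

record ('p, 'u, 'c, 'b) lang =
  link :: "'c \<Rightarrow> 'u \<Rightarrow> 'p"
  behavior :: "'p \<Rightarrow> 'b"

record ('p, 'u, 'c, 'q, 'v, 'd) compiler =
  compile_program :: "'p \<Rightarrow> 'q"
  compile_component :: "'u \<Rightarrow> 'v"
  compile_context :: "'c \<Rightarrow> 'd"

definition modular ::
  "('p, 'u, 'c, 'b) lang \<Rightarrow> ('q, 'v, 'd, 'e) lang \<Rightarrow> ('p, 'u, 'c, 'q, 'v, 'd) compiler \<Rightarrow> bool"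
where
  "modular S T K \<longleftrightarrow>
     (\<forall>C U. behavior T (compile_program K (link S C U)) =
            behavior T (link T (compile_context K C) (compile_component K U)))"

text \<open>The first argument is applied first, matching the argument order of relational
  composition \<open>O\<close> rather than that of function composition.\<close>

definition compose_compilers ::
  "('p, 'u, 'c, 'q, 'v, 'd) compiler \<Rightarrow> ('q, 'v, 'd, 'r, 'w, 'f) compiler
    \<Rightarrow> ('p, 'u, 'c, 'r, 'w, 'f) compiler"
where
  "compose_compilers K K' =
     \<lparr>compile_program = compile_program K' \<circ> compile_program K,
      compile_component = compile_component K' \<circ> compile_component K,
      compile_context = compile_context K' \<circ> compile_context K\<rparr>"

definition exploits ::
  "('p, 'u, 'c, 'b) lang \<Rightarrow> ('q, 'v, 'd, 'e) lang \<Rightarrow> ('p, 'u, 'c, 'q, 'v, 'd) compiler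
    \<Rightarrow> ('b \<times> 'e) set \<Rightarrow> 'd set \<Rightarrow> 'u \<Rightarrow> 'd set"
where
  "exploits S T K R Att V =
     {A \<in> Att. \<not> (\<exists>C. (behavior S (link S C V),
                     behavior T (link T A (compile_component K V))) \<in> R)}"

definition correct_wrt ::
  "('p, 'u, 'c, 'b) lang \<Rightarrow> ('q, 'v, 'd, 'e) lang \<Rightarrow> ('p, 'u, 'c, 'q, 'v, 'd) compiler
    \<Rightarrow> ('b \<times> 'e) set \<Rightarrow> 'u \<Rightarrow> bool"
where
  "correct_wrt S T K R U \<longleftrightarrow>
     (\<forall>C. (behavior S (link S C U),
           behavior T (link T (compile_context K C) (compile_component K U))) \<in> R)"

definition invertible_behaviors :: "('a \<times> 'b) set \<Rightarrow> ('b \<times> 'e) set \<Rightarrow> bool"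
where
  "invertible_behaviors R12 R23 \<longleftrightarrow>
     (\<forall>b1 b3. (b1, b3) \<in> R12 O R23 \<longrightarrow>
        (\<forall>b2. (b2, b3) \<in> R23 \<longleftrightarrow> (b1, b2) \<in> R12))"

end

(* If a source context C reproduces the attack of A on U, then the compiled context reproduces
   it against the compiled component: correctness relates the source behavior to the
   intermediate one, and invertibility lets that intermediate behavior serve as the link to the
   target behavior. *)
theory Submission
  imports Defs
begin

theorem mainTheorem8:
  fixes L1 :: "('p1, 'u1, 'c1, 'b1) lang"
    and L2 :: "('p2, 'u2, 'c2, 'b2) lang"
    and L3 :: "('p3, 'u3, 'c3, 'b3) lang"
    and K12 :: "('p1, 'u1, 'c1, 'p2, 'u2, 'c2) compiler"
    and K23 :: "('p2, 'u2, 'c2, 'p3, 'u3, 'c3) compiler"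
    and R12 :: "('b1 \<times> 'b2) set"
    and R23 :: "('b2 \<times> 'b3) set"
    and Att :: "'c3 set"
    and U :: 'u1
  assumes "modular L1 L2 K12"
    and "modular L2 L3 K23"
    and "correct_wrt L1 L2 K12 R12 U"
    and "invertible_behaviors R12 R23"
  shows "\<forall>A. A \<in> exploits L2 L3 K23 R23 Att (compile_component K12 U) \<longrightarrow>
             A \<in> exploits L1 L3 (compose_compilers K12 K23) (R12 O R23) Att U"
proof (intro allI impI)
  fix A
  assume A: "A \<in> exploits L2 L3 K23 R23 Att (compile_component K12 U)"
  \<comment> \<open>Both exploit sets refer to this one target behavior, since the composite
    compiler sends \<open>U\<close> to the nested compilation.\<close>
  let ?b3 = "behavior L3 (link L3 A (compile_component K23 (compile_component K12 U)))"
  have "(behavior L1 (link L1 C U), ?b3) \<notin> R12 O R23" for C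
  proof
    let ?b2 = "behavior L2 (link L2 (compile_context K12 C) (compile_component K12 U))"
    assume "(behavior L1 (link L1 C U), ?b3) \<in> R12 O R23"
    moreover have "(behavior L1 (link L1 C U), ?b2) \<in> R12"
      using assms(3) unfolding correct_wrt_def by blast
    \<comment> \<open>The middle behavior witnessing \<open>R12 O R23\<close> may differ from
      \<open>?b2\<close>; invertibility holds for every middle behavior, so \<open>R12\<close>
      membership of \<open>?b2\<close> gives the \<open>R23\<close> link.\<close>
    ultimately have "(?b2, ?b3) \<in> R23"
      using assms(4) unfolding invertible_behaviors_def by blast
    \<comment> \<open>\<open>compile_context K12 C\<close> is an \<open>L2\<close> context of the
      kind that \<open>A\<close> rules out.\<close>
    with A show False
      unfolding exploits_def by blast
  qed
  with A show "A \<in> exploits L1 L3 (compose_compilers K12 K23) (R12 O R23) Att U"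
    by (simp add: exploits_def compose_compilers_def)
qed

end
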